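(* Let $\kappa$ be a cardinal with $\omega_1\le\kappa\le\mathrm{cov}(\mathcal{B})$, let $M$ be an ENH-manifold, and let $S$ be a scan in $M$ of some subset $A$ which is $\kappa$-Baire in $M$ and contained in a Euclidean subset $U\subset M$ (e.g. $A=U$, $\kappa=\mathrm{cov}(\mathcal{B})$). Let $E$ be dense in $A$ and let $\lambda<\kappa$ be a cardinal. Then no cover of $S$ by open Hausdorff subsets of $M$ is point-$\lambda$ on $E$.
   Context: A manifold is a connected (in particular nonempty) topological space each of whose points has a neighborhood homeomorphic to $\mathbb{R}^n$ for some fixed integer $n$ (not assumed Hausdorff). A Euclidean subset of an $n$-manifold is a subset homeomorphic to $\mathbb{R}^n$ (it is automatically open). Two points are separated if they have disjoint open neighborhoods; $NH(x)$ is the set of points $y\neq x$ of $M$ which cannot be separated from $x$, and $NH(A)=\bigcup_{x\in A}NH(x)$. An ENH-manifold is a manifold with $NH(x)\neq\varnothing$ for every point $x$. $A$ is $\kappa$-Baire in $M$ if it cannot be covered by fewer than $\kappa$ nowhere dense subsets of $M$. If $Y\cap NH(Y)=\varnothing$ (automatic when $Y$ is contained in an open Hausdorff set), a scan of $Y$ in $M$ is a subset $S\subset NH(Y)$ such that for each $x\in Y$: $NH(x)\neq\varnothing$ iff $NH(x)\cap S\neq\varnothing$. $\mathrm{cov}(\mathcal{B})$ is the smallest cardinal $\mu$ such that $\mathbb{R}^n$ ($1\le n<\omega$) can be covered by at most $\mu$ nowhere dense subsets (it does not depend on $n$). A collection $\mathcal{V}$ of open sets is point-$\lambda$ on $E$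 if every member of $E$ belongs to at most $\lambda$ members of $\mathcal{V}$. *)

theory Defs
  imports "HOL-Analysis.Analysis"
begin

unbundle cardinal_syntax

text \<open>
  \<open>Euclidean_space n\<close> is \<open>\<real>\<^sup>n\<close> with the dimension as a natural number. Manifolds are not
  assumed Hausdorff, nor second countable. By invariance of dimension the \<open>n\<close> below is
  determined by \<open>M\<close>.
\<close>

definition manifold :: "nat \<Rightarrow> 'a topology \<Rightarrow> bool" where
  "manifold n M \<longleftrightarrow>
     topspace M \<noteq> {} \<and> connected_space M \<and>
     (\<forall>x\<in>topspace M. \<exists>N \<subseteq> topspace M. x \<in> M interior_of N \<and>
        subtopology M N homeomorphic_space Euclidean_space n)"

definition Euclidean_subset :: "nat \<Rightarrow> 'a topology \<Rightarrow> 'a set \<Rightarrow> bool" where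
  "Euclidean_subset n M U \<longleftrightarrow>
     U \<subseteq> topspace M \<and> subtopology M U homeomorphic_space Euclidean_space n"

definition points_separated :: "'a topology \<Rightarrow> 'a \<Rightarrow> 'a \<Rightarrow> bool" where
  "points_separated M x y \<longleftrightarrow>
     (\<exists>V W. openin M V \<and> openin M W \<and> x \<in> V \<and> y \<in> W \<and> disjnt V W)"

definition NH :: "'a topology \<Rightarrow> 'a \<Rightarrow> 'a set" where
  "NH M x = {y \<in> topspace M. y \<noteq> x \<and> \<not> points_separated M x y}"

definition NH_set :: "'a topology \<Rightarrow> 'a set \<Rightarrow> 'a set" where
  "NH_set M A = (\<Union>x\<in>A. NH M x)"

definition ENH_manifold :: "nat \<Rightarrow> 'a topology \<Rightarrow> bool" where
  "ENH_manifold n M \<longleftrightarrow> manifold n M \<and> (\<forall>x\<in>topspace M. NH M x \<noteq> {})"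

text \<open>
  The requirement that \<open>Y\<close> misses \<open>NH_set M Y\<close> is the proviso under which scans of \<open>Y\<close> are
  defined; it is automatic when \<open>Y\<close> lies in an open Hausdorff set.
\<close>

definition scan :: "'a topology \<Rightarrow> 'a set \<Rightarrow> 'a set \<Rightarrow> bool" where
  "scan M Y S \<longleftrightarrow>
     Y \<subseteq> topspace M \<and> Y \<inter> NH_set M Y = {} \<and> S \<subseteq> NH_set M Y \<and>
     (\<forall>x\<in>Y. NH M x \<noteq> {} \<longleftrightarrow> NH M x \<inter> S \<noteq> {})"

definition nowhere_dense_in :: "'a topology \<Rightarrow> 'a set \<Rightarrow> bool" where
  "nowhere_dense_in M N \<longleftrightarrow> N \<subseteq> topspace M \<and> M interior_of (M closure_of N) = {}"

definition nowhere_dense_cover :: "'a topology \<Rightarrow> 'a set \<Rightarrow> 'a set set \<Rightarrow> bool" where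
  "nowhere_dense_cover M A \<C> \<longleftrightarrow> (\<forall>N\<in>\<C>. nowhere_dense_in M N) \<and> A \<subseteq> \<Union>\<C>"

text \<open>
  Cardinals are represented, as in the library, by relations satisfying \<open>Card_order\<close>, compared
  by \<open>\<le>o\<close> and \<open><o\<close> across types.
\<close>

definition card_Baire_in :: "'k rel \<Rightarrow> 'a topology \<Rightarrow> 'a set \<Rightarrow> bool" where
  "card_Baire_in \<kappa> M A \<longleftrightarrow>
     A \<subseteq> topspace M \<and> \<not> (\<exists>\<C>. nowhere_dense_cover M A \<C> \<and> |\<C>| <o \<kappa>)"

text \<open>
  The cardinality of a smallest cover of \<open>\<real>\<^sup>n\<close> by nowhere dense sets. It is meaningful for
  \<open>n \<ge> 1\<close> (there are no such covers of \<open>\<real>\<^sup>0\<close>), and then independent of \<open>n\<close>.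
\<close>

definition cov_B :: "nat \<Rightarrow> (nat \<Rightarrow> real) set rel" where
  "cov_B n =
     |SOME \<C>. nowhere_dense_cover (Euclidean_space n) (topspace (Euclidean_space n)) \<C> \<and>
        (\<forall>\<D>. nowhere_dense_cover (Euclidean_space n) (topspace (Euclidean_space n)) \<D> \<longrightarrow>
           |\<C>| \<le>o |\<D>| )|"

definition point_card_on :: "'l rel \<Rightarrow> 'a set set \<Rightarrow> 'a set \<Rightarrow> bool" where
  "point_card_on \<mu> \<V> E \<longleftrightarrow> (\<forall>x\<in>E. |{V \<in> \<V>. x \<in> V}| \<le>o \<mu>)"

definition open_Hausdorff_cover :: "'a topology \<Rightarrow> 'a set \<Rightarrow> 'a set set \<Rightarrow> bool" where
  "open_Hausdorff_cover M S \<V> \<longleftrightarrow>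
     (\<forall>V\<in>\<V>. openin M V \<and> Hausdorff_space (subtopology M V)) \<and> S \<subseteq> \<Union>\<V>"

lemma nowhere_dense_in_singleton:
  assumes "1 \<le> n" and x: "x \<in> topspace (Euclidean_space n)"
  shows "nowhere_dense_in (Euclidean_space n) {x}"
proof -
  let ?E = "Euclidean_space n"
  have cl: "closedin ?E {x}"
    using Hausdorff_Euclidean_space x by (metis closedin_Hausdorff_sing_eq)
  have "?E interior_of {x} = {}"
  proof (rule ccontr)
    assume "?E interior_of {x} \<noteq> {}"
    then have "openin ?E {x}"
      by (metis interior_of_subset openin_interior_of subset_singletonD)
    then have "topspace ?E = {x}"
      using cl connected_Euclidean_space[of n] unfolding connected_space_clopen_in by blast
    moreover have "(\<lambda>i. 0) \<in> topspace ?E" "(\<lambda>i. if i = 0 then 1 else 0) \<in> topspace ?E"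
      using assms(1) by (auto simp: topspace_Euclidean_space)
    ultimately have "(\<lambda>i::nat. 0::real) = (\<lambda>i. if i = 0 then 1 else 0)" by (metis singletonD)
    then show False by (metis zero_neq_one)
  qed
  then show ?thesis
    using cl x by (simp add: nowhere_dense_in_def closure_of_closedin)
qed

lemma cov_B_minimal:
  assumes "1 \<le> n"
  shows "\<exists>\<C>. nowhere_dense_cover (Euclidean_space n) (topspace (Euclidean_space n)) \<C> \<and>
           cov_B n = |\<C>|"
    and "nowhere_dense_cover (Euclidean_space n) (topspace (Euclidean_space n)) \<D> \<Longrightarrow>
           cov_B n \<le>o |\<D>|"
proof -
  let ?P = "nowhere_dense_cover (Euclidean_space n) (topspace (Euclidean_space n))"
  let ?Q = "\<lambda>\<C>. ?P \<C> \<and> (\<forall>\<D>. ?P \<D> \<longrightarrow> |\<C>| \<le>o |\<D>| )"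
  have "?P ((\<lambda>x. {x}) ` topspace (Euclidean_space n))"
    using nowhere_dense_in_singleton[OF assms] by (auto simp: nowhere_dense_cover_def)
  then have "\<exists>r \<in> card_of ` Collect ?P. \<forall>r' \<in> card_of ` Collect ?P. r \<le>o r'"
    by (intro exists_minim_Card_order) (auto simp: card_of_Card_order)
  then have "\<exists>\<C>. ?Q \<C>" by auto
  then have Q: "?Q (SOME \<C>. ?Q \<C>)" by (rule someI_ex)
  show "\<exists>\<C>. ?P \<C> \<and> cov_B n = |\<C>|" using Q unfolding cov_B_def by blast
  show "?P \<D> \<Longrightarrow> cov_B n \<le>o |\<D>|" using Q unfolding cov_B_def by blast
qed

end

theory Submission
  imports Defs "HOL-Library.Countable_Set_Type"
begin

text \<open>
  Suppose that \<open>\<V>\<close> covers the scan \<open>S\<close> by open Hausdorff sets. A point \<open>x\<close> of \<open>A\<close> has a partner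
  \<open>y\<close> in \<open>S\<close> from which it cannot be separated, and \<open>y\<close> lies in some \<open>V\<close> of \<open>\<V>\<close>. Since \<open>V\<close> is
  an open Hausdorff set, it cannot contain \<open>x\<close>; since \<open>V\<close> is a neighbourhood of \<open>y\<close>, it meets
  every neighbourhood of \<open>x\<close>. So \<open>x\<close> lies on the frontier of \<open>V\<close>, which is nowhere dense
  (\<open>NH_in_frontier\<close>, \<open>nowhere_dense_in_frontier_of_openin\<close>).

  The frontiers of all members of \<open>\<V>\<close> may be too many to contradict the Baire property of \<open>A\<close>,
  but few of them suffice. A subset of a Euclidean space is separable, so \<open>E\<close> has a countable
  dense subset \<open>D\<close>, and \<open>D\<close> is dense in \<open>A\<close>. If \<open>x\<close> is interior to the closure of \<open>A\<close>, then \<open>V\<close>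
  meets that interior, hence meets \<open>D\<close>. The remaining points of \<open>A\<close> lie on the frontier of the
  closure of \<open>A\<close>, a single nowhere dense set (\<open>scan_subset_frontiers\<close>).

  If \<open>\<V>\<close> were point-\<open>\<mu>\<close> on \<open>E\<close>, at most \<open>\<omega> \<cdot> \<mu>\<close> members of \<open>\<V>\<close> would meet \<open>D\<close>, and this is less
  than \<open>\<kappa>\<close> because \<open>\<kappa>\<close> is uncountable and \<open>\<mu> < \<kappa>\<close>. Then \<open>A\<close> would be covered by fewer
  than \<open>\<kappa>\<close> nowhere dense sets.
\<close>

section \<open>Nowhere dense frontiers\<close>

lemma nowhere_dense_in_frontier_of_closedin:
  assumes "closedin M C"
  shows "nowhere_dense_in M (M frontier_of C)"
proof -
  have "M interior_of (M frontier_of C) \<subseteq> M interior_of C"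
    using assms by (simp add: interior_of_mono frontier_of_subset_closedin)
  moreover have "M interior_of (M frontier_of C) \<inter> M interior_of C = {}"
    using interior_of_subset[of M "M frontier_of C"] by (auto simp: frontier_of_def)
  ultimately have "M interior_of (M frontier_of C) = {}" by blast
  then show ?thesis
    by (simp add: nowhere_dense_in_def frontier_of_subset_topspace closure_of_closedin
        closedin_frontier_of)
qed

lemma nowhere_dense_in_frontier_of_openin:
  assumes "openin M V"
  shows "nowhere_dense_in M (M frontier_of V)"
  using nowhere_dense_in_frontier_of_closedin[of M "topspace M - V"] assms
  by (simp add: frontier_of_complement openin_closedin_eq)

section \<open>Points that cannot be separated\<close>

lemma NH_neighbourhoods_meet:
  assumes "y \<in> NH M x" "openin M V" "y \<in> V" "openin M W" "x \<in> W"
  shows "W \<inter> V \<noteq> {}"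
  using assms unfolding NH_def points_separated_def disjnt_def by blast

text \<open>
  Disjoint relatively open subsets of \<open>V\<close> are open in the whole space, so a Hausdorff open set
  containing \<open>y\<close> would separate \<open>x\<close> from \<open>y\<close> if it contained \<open>x\<close>.
\<close>
lemma NH_in_frontier:
  assumes x: "x \<in> topspace M" and y: "y \<in> NH M x" "y \<in> V"
    and V: "openin M V" and H: "Hausdorff_space (subtopology M V)"
  shows "x \<in> M frontier_of V"
proof -
  have "x \<notin> V"
  proof
    assume "x \<in> V"
    then have "x \<in> topspace (subtopology M V)" "y \<in> topspace (subtopology M V)" "x \<noteq> y"
      using x y by (auto simp: NH_def)
    then obtain P Q where "openin (subtopology M V) P" "openin (subtopology M V) Q"
      "x \<in> P" "y \<in> Q" "disjnt P Q"
      using H unfolding Hausdorff_space_def by meson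
    then have "points_separated M x y"
      unfolding points_separated_def using openin_open_subtopology[OF V] by blast
    then show False using y(1) by (simp add: NH_def)
  qed
  moreover have "x \<in> M closure_of V"
    using x NH_neighbourhoods_meet[OF y(1) V y(2)] unfolding in_closure_of by blast
  ultimately show ?thesis
    using V by (simp add: frontier_of_openin)
qed

text \<open>
  Intersecting with the interior of the closure of \<open>A\<close> is what makes density in \<open>A\<close> enough: an
  open set whose frontier contains a point of \<open>A\<close> may miss \<open>A\<close> altogether.
\<close>
lemma scan_subset_frontiers:
  assumes scan: "scan M A S" and NH: "\<And>x. x \<in> A \<Longrightarrow> NH M x \<noteq> {}"
    and cover: "open_Hausdorff_cover M S \<V>" and dense: "A \<subseteq> M closure_of D"
  shows "A \<subseteq> M frontier_of (M closure_of A) \<union> (\<Union>V\<in>{V \<in> \<V>. V \<inter> D \<noteq> {}}. M frontier_of V)"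
proof
  fix x assume xA: "x \<in> A"
  have A: "A \<subseteq> topspace M" using scan by (simp add: scan_def)
  with xA have x: "x \<in> topspace M" by blast
  let ?W = "M interior_of (M closure_of A)"
  show "x \<in> M frontier_of (M closure_of A) \<union> (\<Union>V\<in>{V \<in> \<V>. V \<inter> D \<noteq> {}}. M frontier_of V)"
  proof (cases "x \<in> ?W")
    case False
    then show ?thesis
      using xA closure_of_subset[OF A] by (auto simp: frontier_of_def)
  next
    case True
    have "NH M x \<inter> S \<noteq> {}"
      using scan NH[OF xA] xA by (simp add: scan_def)
    moreover have "S \<subseteq> \<Union>\<V>"
      using cover by (simp add: open_Hausdorff_cover_def)
    ultimately obtain y V where y: "y \<in> NH M x" "y \<in> V" and V: "V \<in> \<V>" by blast
    have opV: "openin M V" and H: "Hausdorff_space (subtopology M V)"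
      using cover V by (auto simp: open_Hausdorff_cover_def)
    have "?W \<inter> V \<noteq> {}"
      using NH_neighbourhoods_meet[OF y(1) opV y(2) openin_interior_of True] .
    then obtain z where "z \<in> V" "z \<in> M closure_of A"
      using interior_of_subset[of M "M closure_of A"] by blast
    moreover have "M closure_of A \<subseteq> M closure_of D"
      using dense by (simp add: closure_of_minimal)
    ultimately have "V \<inter> D \<noteq> {}"
      using opV by (metis (no_types, lifting) disjoint_iff in_closure_of subsetD)
    then show ?thesis
      using NH_in_frontier[OF x y opV H] V by blast
  qed
qed

section \<open>Separability of Euclidean subsets\<close>

lemma second_countable_euclidean:
  "second_countable (euclidean :: 'b::second_countable_topology topology)"
proof -
  obtain B :: "'b set set" where "countable B" and B: "\<And>C. C \<in> B \<Longrightarrow> open C"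
    and U: "\<And>S. open S \<Longrightarrow> \<exists>U. U \<subseteq> B \<and> S = \<Union>U"
    using univ_second_countable by metis
  have "\<exists>V\<in>B. x \<in> V \<and> V \<subseteq> S" if "open S" "x \<in> S" for S x
    using U[OF that(1)] that(2) by blast
  then show ?thesis
    unfolding second_countable_def using \<open>countable B\<close> B by auto
qed

lemma second_countable_Euclidean_space: "second_countable (Euclidean_space n)"
  unfolding Euclidean_space_def euclidean_product_topology
  by (intro second_countable_subtopology second_countable_euclidean)

lemma second_countable_subset_imp_countable_dense:
  assumes sc: "second_countable (subtopology M U)" and "E \<subseteq> U" "E \<subseteq> topspace M"
  obtains D where "countable D" "D \<subseteq> E" "E \<subseteq> M closure_of D"
proof -
  have "second_countable (subtopology M E)"
    using second_countable_subtopology[OF sc, of E] \<open>E \<subseteq> U\<close>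
    by (simp add: subtopology_subtopology inf.absorb2)
  then have "separable_space (subtopology M E)"
    by (rule second_countable_imp_separable_space)
  then obtain D where D: "countable D" "D \<subseteq> E"
    "subtopology M E closure_of D = topspace (subtopology M E)"
    unfolding separable_space_def by auto
  then have "E \<subseteq> M closure_of D"
    using \<open>E \<subseteq> topspace M\<close> closure_of_mono[of "E \<inter> D" D M]
    by (auto simp: closure_of_subtopology)
  with D show thesis using that by blast
qed

section \<open>Counting the members that meet a countable set\<close>

lemma point_card_on_countable:
  assumes \<kappa>: "Card_order \<kappa>" and unc: "natLeq <o \<kappa>"
    and \<mu>: "Card_order \<mu>" "\<mu> <o \<kappa>"
    and D: "countable D" and pc: "point_card_on \<mu> \<V> D"
  shows "|{V \<in> \<V>. V \<inter> D \<noteq> {}}| <o \<kappa>"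
proof -
  \<comment> \<open>A sum rather than a case distinction gives an infinite bound also when \<open>\<mu>\<close> is finite.\<close>
  let ?r = "natLeq +c \<mu>"
  have fld: "|Field (natLeq)| <o \<kappa>" "|Field \<mu>| <o \<kappa>"
    by (rule ordIso_ordLess_trans[OF card_of_Field_ordIso[OF natLeq_Card_order] unc],
        rule ordIso_ordLess_trans[OF card_of_Field_ordIso[OF \<mu>(1)] \<mu>(2)])
  have inf: "\<not> finite (Field \<kappa>)"
    using cinfinite_mono[OF ordLess_imp_ordLeq[OF unc] natLeq_cinfinite]
    by (simp add: cinfinite_def)
  have r: "?r <o \<kappa>"
    unfolding csum_def by (rule card_of_Plus_ordLess_infinite_Field[OF inf \<kappa> fld])
  have ci: "Cinfinite ?r"
    by (rule Cinfinite_csum1[OF natLeq_Cinfinite])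
  have "|D| \<le>o natLeq"
    using D by (simp add: countable_card_le_natLeq)
  then have "|D| \<le>o ?r"
    by (rule ordLeq_transitive[OF _ ordLeq_csum1[OF natLeq_Card_order]])
  moreover have "\<forall>d\<in>D. |{V \<in> \<V>. d \<in> V}| \<le>o ?r"
    using pc unfolding point_card_on_def
    by (auto intro: ordLeq_transitive[OF _ ordLeq_csum2[OF \<mu>(1)]])
  ultimately have "|\<Union>d\<in>D. {V \<in> \<V>. d \<in> V}| \<le>o ?r"
    using ci by (rule UNION_Cinfinite_bound)
  moreover have "{V \<in> \<V>. V \<inter> D \<noteq> {}} = (\<Union>d\<in>D. {V \<in> \<V>. d \<in> V})" by blast
  ultimately show ?thesis
    using ordLeq_ordLess_trans[OF _ r] by simp
qed

section \<open>Covers of a scan that are point-small on a dense subset\<close>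

theorem theorem3p7:
  fixes M :: "'a topology" and n m :: nat
    and A U S E :: "'a set"
    and \<kappa> :: "'k rel" and \<mu> :: "'l rel"
  assumes "Card_order \<kappa>"
    and "cardSuc natLeq \<le>o \<kappa>"
    and "1 \<le> m" and "\<kappa> \<le>o cov_B m"
    and "ENH_manifold n M"
    and "Euclidean_subset n M U" and "A \<subseteq> U"
    and "card_Baire_in \<kappa> M A"
    and "scan M A S"
    and "E \<subseteq> A" and "A \<subseteq> M closure_of E"
    and "Card_order \<mu>" and "\<mu> <o \<kappa>"
  shows "\<not> (\<exists>\<V>. open_Hausdorff_cover M S \<V> \<and> point_card_on \<mu> \<V> E)"
proof (rule notI, elim exE conjE)
  fix \<V> assume cover: "open_Hausdorff_cover M S \<V>" and pc: "point_card_on \<mu> \<V> E"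
  have unc: "natLeq <o \<kappa>"
    by (rule ordLess_ordLeq_trans[OF cardSuc_greater[OF natLeq_Card_order] assms(2)])
  have inf: "\<not> finite (Field \<kappa>)"
    using cinfinite_mono[OF ordLess_imp_ordLeq[OF unc] natLeq_cinfinite]
    by (simp add: cinfinite_def)
  have A: "A \<subseteq> topspace M"
    using assms(9) by (simp add: scan_def)
  have "second_countable (subtopology M U)"
    using assms(6) second_countable_Euclidean_space[of n]
      homeomorphic_space_second_countability[of "subtopology M U" "Euclidean_space n"]
    by (simp add: Euclidean_subset_def)
  then obtain D where D: "countable D" "D \<subseteq> E" "E \<subseteq> M closure_of D"
    using second_countable_subset_imp_countable_dense[of M U E] assms(7,10) A by blast
  have dense: "A \<subseteq> M closure_of D"
    using assms(11) closure_of_minimal[OF D(3) closedin_closure_of] by blast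
  define \<W> where "\<W> = {V \<in> \<V>. V \<inter> D \<noteq> {}}"
  have small: "|\<W>| <o \<kappa>"
    unfolding \<W>_def using point_card_on_countable[OF assms(1) unc assms(12,13) D(1)] pc D(2)
    by (auto simp: point_card_on_def)
  let ?\<C> = "{M frontier_of (M closure_of A)} \<union> (\<lambda>V. M frontier_of V) ` \<W>"
  have NH: "NH M x \<noteq> {}" if "x \<in> A" for x
    using assms(5) that A by (auto simp: ENH_manifold_def)
  have "nowhere_dense_in M N" if "N \<in> ?\<C>" for N
    using that cover
    by (auto simp: \<W>_def open_Hausdorff_cover_def nowhere_dense_in_frontier_of_closedin
        intro: nowhere_dense_in_frontier_of_openin)
  then have "nowhere_dense_cover M A ?\<C>"
    using scan_subset_frontiers[OF assms(9) NH cover dense]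
    unfolding nowhere_dense_cover_def \<W>_def by auto
  moreover have "|?\<C>| <o \<kappa>"
  proof (rule card_of_Un_ordLess_infinite_Field[OF inf assms(1)])
    show "|{M frontier_of (M closure_of A)}| <o \<kappa>"
      by (rule finite_ordLess_infinite[OF card_of_Well_order
            card_order_on_well_order_on[OF assms(1)] _ inf]) (simp add: Field_card_of)
    show "|(\<lambda>V. M frontier_of V) ` \<W>| <o \<kappa>"
      by (rule ordLeq_ordLess_trans[OF card_of_image small])
  qed
  ultimately show False
    using assms(8) unfolding card_Baire_in_def by blast
qed

end
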